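(* Let $X$ be a real Hilbert space, let $m\in\{2,3,\dots\}$, and let $A_1,\dots,A_m: X\rightrightarrows X$ be maximally monotone operators with resolvents $J_1,\dots,J_m$. Suppose that $\operatorname{Fix}J_i\neq\varnothing$ for each $1\le i\le m$. Then the following are equivalent: (1) $\bigcap_{i=1}^m\operatorname{Fix}J_i\neq\varnothing$; (2) $F_1=F_2=\cdots=F_m\neq\varnothing$.
   Context: $J_i=(\mathrm{Id}+A_i)^{-1}$ is the resolvent of $A_i$. $\operatorname{Fix}S=\{x\mid x=Sx\}$. For $i\in\{1,\dots,m\}$, $F_i:=\operatorname{Fix}(J_iJ_{i-1}\cdots J_1J_m\cdots J_{i+1})$; thus $F_1=\operatorname{Fix}(J_1J_m\cdots J_2)$, $F_2=\operatorname{Fix}(J_2J_1J_m\cdots J_3)$, ..., $F_m=\operatorname{Fix}(J_mJ_{m-1}\cdots J_1)$. *)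

theory Defs
  imports "HOL-Analysis.Analysis"
begin

text \<open>A set-valued operator on \<open>X\<close> is a function of type \<open>'a \<Rightarrow> 'a set\<close>; a Hilbert space is a type of
  sort \<open>{real_inner, complete_space}\<close>.\<close>

definition monotone_op :: "('a::real_inner \<Rightarrow> 'a set) \<Rightarrow> bool" where
  "monotone_op A \<longleftrightarrow> (\<forall>x y. \<forall>u\<in>A x. \<forall>v\<in>A y. inner (x - y) (u - v) \<ge> 0)"

definition maximally_monotone :: "('a::real_inner \<Rightarrow> 'a set) \<Rightarrow> bool" where
  "maximally_monotone A \<longleftrightarrow>
     monotone_op A \<and> (\<forall>B. monotone_op B \<and> (\<forall>x. A x \<subseteq> B x) \<longrightarrow> B = A)"

definition op_add :: "('a::real_inner \<Rightarrow> 'a set) \<Rightarrow> ('a \<Rightarrow> 'a set) \<Rightarrow> 'a \<Rightarrow> 'a set" where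
  "op_add A B x = {u + v | u v. u \<in> A x \<and> v \<in> B x}"

definition op_Id :: "'a \<Rightarrow> 'a set" where
  "op_Id x = {x}"

definition op_inverse :: "('a \<Rightarrow> 'a set) \<Rightarrow> 'a \<Rightarrow> 'a set" where
  "op_inverse A u = {x. u \<in> A x}"

text \<open>The resolvent as a map \<open>X \<rightarrow> X\<close>: for maximally monotone \<open>A\<close> on a Hilbert space the set-valued
  inverse of \<open>Id + A\<close> takes exactly one value at each point (Minty's theorem), and the description
  operator selects it. For other \<open>A\<close> the value may be unspecified.\<close>

definition resolvent :: "('a::real_inner \<Rightarrow> 'a set) \<Rightarrow> 'a \<Rightarrow> 'a" where
  "resolvent A x = (THE y. y \<in> op_inverse (op_add op_Id A) x)"

definition Fix :: "('a \<Rightarrow> 'a) \<Rightarrow> 'a set" where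
  "Fix S = {x. x = S x}"

text \<open>The index list is \<open>i, i - 1, \<dots>, 1, m, m - 1, \<dots>, i + 1\<close>, and the leftmost factor of the composition
  is applied last.\<close>

definition cyclic_comp :: "(nat \<Rightarrow> 'a \<Rightarrow> 'a) \<Rightarrow> nat \<Rightarrow> nat \<Rightarrow> 'a \<Rightarrow> 'a" where
  "cyclic_comp J m i = foldr (\<circ>) (map J (rev [1..<Suc i] @ rev [Suc i..<Suc m])) id"

definition cyclic_Fix :: "(nat \<Rightarrow> 'a::real_inner \<Rightarrow> 'a set) \<Rightarrow> nat \<Rightarrow> nat \<Rightarrow> 'a set" where
  "cyclic_Fix A m i = Fix (cyclic_comp (\<lambda>k. resolvent (A k)) m i)"

end

theory Submission
  imports Defs
begin

text \<open>
  The resolvents \<open>J\<^sub>i\<close> are firmly nonexpansive self-maps of \<open>X\<close>, and both implications rest on this.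
  Suppose first that there is a common fixed point \<open>z\<close>. Applying a firmly nonexpansive map that fixes \<open>z\<close> to a point it moves brings that point strictly closer to \<open>z\<close>;
  a fixed point of any composition of the \<open>J\<^sub>i\<close> returns to its own distance from \<open>z\<close>, so no factor
  can have moved it. Hence each \<open>F\<^sub>i\<close> is the set of common fixed points
  (\<open>Fix_composition_eq_Inter_Fix\<close>).

  Conversely, let \<open>F\<close> be the common value of the \<open>F\<^sub>i\<close>. Cyclically consecutive compositions have the
  form \<open>R \<circ> J\<close> and \<open>J \<circ> R\<close> with \<open>J = J\<^sub>i\<^sub>+\<^sub>1\<close> and \<open>R\<close> nonexpansive. As \<open>R \<circ> J\<close> fixes the points of
  \<open>F\<close>, the map \<open>J\<close> is isometric on \<open>F\<close>, and for a firmly nonexpansive map this means that it acts on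
  \<open>F\<close> as a translation by some vector \<open>d\<close>. As \<open>J\<close> maps \<open>Fix (R \<circ> J) = F\<close> into \<open>Fix (J \<circ> R) = F\<close>, the
  translation can be iterated: the orbit of \<open>x \<in> F\<close> under \<open>J\<close> is \<open>x + n d\<close>. But \<open>J\<close> has a fixed point,
  so its orbits are bounded, \<open>d = 0\<close>, and \<open>J\<close> fixes every point of \<open>F\<close>
  (\<open>Fix_commuted_composition_subset_Fix\<close>).

  That a resolvent is defined everywhere is Minty's theorem (\<open>minty\<close>). The proof here minimises
  \<open>\<Phi>(y, w) + (\<parallel>y\<parallel>\<^sup>2 + \<parallel>w\<parallel>\<^sup>2) / 2\<close> over \<open>X \<times> X\<close>, where \<open>\<Phi>\<close> is the Fitzpatrick function
  \<open>\<Phi>(y, w) = sup {\<langle>y, b\<rangle> + \<langle>a, w\<rangle> - \<langle>a, b\<rangle> | b \<in> A a}\<close>. This function is convex and lower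
  semicontinuous and satisfies \<open>\<Phi>(y, w) \<ge> \<langle>y, w\<rangle>\<close>, so strong convexity and completeness provide a
  minimiser \<open>(y, w)\<close>, and the optimality condition there says that \<open>w = - y \<in> A y\<close>. To avoid
  infinite values the argument runs on the epigraph of \<open>\<Phi>\<close>.
\<close>

section \<open>Minimising a strongly convex function given by its epigraph\<close>

text \<open>At the midpoint of two points of the epigraph the objective lies below its mean by an eighth of
  the squared distance of their base points (parallelogram law), so minimising sequences are Cauchy; the height along such a sequence
  converges as well, because the objective does.\<close>

lemma regularised_epigraph_has_minimum:
  fixes K :: "('h::{real_inner, complete_space} \<times> real) set"
  assumes "closed K" "convex K" "K \<noteq> {}"
    and below: "\<And>z t. (z, t) \<in> K \<Longrightarrow> c \<le> t + (norm z)\<^sup>2 / 2"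
  obtains z0 t0 where "(z0, t0) \<in> K"
    and "\<And>z t. (z, t) \<in> K \<Longrightarrow> t0 + (norm z0)\<^sup>2 / 2 \<le> t + (norm z)\<^sup>2 / 2"
proof -
  define \<phi> where "\<phi> p = snd p + (norm (fst p))\<^sup>2 / 2" for p :: "'h \<times> real"
  define \<mu> where "\<mu> = Inf (\<phi> ` K)"
  have bdd: "bdd_below (\<phi> ` K)"
    using below by (intro bdd_belowI2[where m = c]) (auto simp: \<phi>_def)
  have \<mu>_le: "\<mu> \<le> \<phi> p" if "p \<in> K" for p
    unfolding \<mu>_def using bdd that by (rule cINF_lower)
  have "\<exists>p\<in>K. \<phi> p < \<mu> + inverse (real (Suc n))" for n
  proof -
    have "Inf (\<phi> ` K) < \<mu> + inverse (real (Suc n))"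
      by (simp add: \<mu>_def)
    then show ?thesis
      using cInf_lessD[of "\<phi> ` K"] \<open>K \<noteq> {}\<close> by auto
  qed
  then obtain p where pK: "\<And>n. p n \<in> K" and p_less: "\<And>n. \<phi> (p n) < \<mu> + inverse (real (Suc n))"
    by metis
  define z where "z n = fst (p n)" for n
  have gap: "(norm (fst q - fst r))\<^sup>2 \<le> 4 * ((\<phi> q - \<mu>) + (\<phi> r - \<mu>))"
    if "q \<in> K" "r \<in> K" for q r
  proof -
    have "(1/2) *\<^sub>R q + (1/2) *\<^sub>R r \<in> K"
      using \<open>convex K\<close> that by (intro convexD) auto
    then have "\<mu> \<le> \<phi> ((1/2) *\<^sub>R q + (1/2) *\<^sub>R r)"
      by (rule \<mu>_le)
    also have "\<dots> = (\<phi> q + \<phi> r) / 2 - (norm (fst q - fst r))\<^sup>2 / 8"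
      by (simp add: \<phi>_def power2_norm_eq_inner inner_add_left inner_add_right
          inner_diff_left inner_diff_right inner_commute field_simps)
    finally show ?thesis by argo
  qed
  have "Cauchy z"
  proof (rule metric_CauchyI)
    fix e :: real assume "0 < e"
    then obtain N where N: "inverse (real (Suc N)) < e\<^sup>2 / 8"
      using reals_Archimedean[of "e\<^sup>2 / 8"] by auto
    show "\<exists>M. \<forall>m\<ge>M. \<forall>n\<ge>M. dist (z m) (z n) < e"
    proof (intro exI allI impI)
      fix m n assume "N \<le> m" "N \<le> n"
      have small: "\<phi> (p k) - \<mu> < e\<^sup>2 / 8" if "N \<le> k" for k
      proof -
        have "inverse (real (Suc k)) \<le> inverse (real (Suc N))"
          using that by (intro le_imp_inverse_le) auto
        then show ?thesis using p_less[of k] N by linarith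
      qed
      have "(norm (z m - z n))\<^sup>2 < e\<^sup>2"
        using gap[OF pK[of m] pK[of n]] small[OF \<open>N \<le> m\<close>] small[OF \<open>N \<le> n\<close>]
        by (simp add: z_def)
      then show "dist (z m) (z n) < e"
        using \<open>0 < e\<close> by (simp add: dist_norm power_less_imp_less_base)
    qed
  qed
  then obtain z0 where z0: "z \<longlonglongrightarrow> z0"
    using Cauchy_convergent convergent_def by blast
  have "(\<lambda>n. \<phi> (p n)) \<longlonglongrightarrow> \<mu>"
  proof (rule tendsto_sandwich[where f = "\<lambda>n. \<mu>"])
    show "(\<lambda>n. \<mu> + inverse (real (Suc n))) \<longlonglongrightarrow> \<mu>"
      using tendsto_add[OF tendsto_const LIMSEQ_inverse_real_of_nat] by simp
    show "\<forall>\<^sub>F n in sequentially. \<mu> \<le> \<phi> (p n)"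
      using \<mu>_le pK by simp
    show "\<forall>\<^sub>F n in sequentially. \<phi> (p n) \<le> \<mu> + inverse (real (Suc n))"
      using p_less by (simp add: less_imp_le)
  qed simp
  then have "(\<lambda>n. \<phi> (p n) - (norm (z n))\<^sup>2 / 2) \<longlonglongrightarrow> \<mu> - (norm z0)\<^sup>2 / 2"
    by (intro tendsto_intros z0) simp_all
  then have "(\<lambda>n. snd (p n)) \<longlonglongrightarrow> \<mu> - (norm z0)\<^sup>2 / 2"
    by (simp add: \<phi>_def z_def)
  then have "p \<longlonglongrightarrow> (z0, \<mu> - (norm z0)\<^sup>2 / 2)"
    using tendsto_Pair[OF z0, of "\<lambda>n. snd (p n)"] by (simp add: z_def)
  then have "(z0, \<mu> - (norm z0)\<^sup>2 / 2) \<in> K"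
    using \<open>closed K\<close> pK closed_sequentially by blast
  then show thesis
    using \<mu>_le by (intro that) (force simp: \<phi>_def)+
qed

text \<open>The first-order optimality condition: at the minimiser, the negative gradient \<open>- z0\<close> of the quadratic
  term is a subgradient of the function with epigraph \<open>K\<close>.\<close>

lemma regularised_epigraph_minimum_variational:
  fixes K :: "('h::real_inner \<times> real) set"
  assumes "convex K" "(z0, t0) \<in> K" "(z, t) \<in> K"
    and min: "\<And>z t. (z, t) \<in> K \<Longrightarrow> t0 + (norm z0)\<^sup>2 / 2 \<le> t + (norm z)\<^sup>2 / 2"
  shows "t0 \<le> t + inner z0 (z - z0)"
proof -
  define c where "c = t - t0 + inner z0 (z - z0)"
  define d where "d = (norm (z - z0))\<^sup>2 / 2"
  have step: "0 \<le> c + s * d" if "0 < s" "s < 1" for s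
  proof -
    have "(1 - s) *\<^sub>R (z0, t0) + s *\<^sub>R (z, t) \<in> K"
      using assms(1-3) that by (intro convexD) auto
    then have "(z0 + s *\<^sub>R (z - z0), t0 + s * (t - t0)) \<in> K"
      by (simp add: algebra_simps)
    then have "t0 + (norm z0)\<^sup>2 / 2 \<le> t0 + s * (t - t0) + (norm (z0 + s *\<^sub>R (z - z0)))\<^sup>2 / 2"
      by (rule min)
    also have "(norm (z0 + s *\<^sub>R (z - z0)))\<^sup>2
        = (norm z0)\<^sup>2 + 2 * s * inner z0 (z - z0) + s * s * (norm (z - z0))\<^sup>2"
      unfolding power2_norm_eq_inner
      by (simp add: inner_add_left inner_add_right inner_commute[of z z0] algebra_simps)
    finally have "0 \<le> s * (c + s * d)"
      by (simp add: c_def d_def power2_eq_square algebra_simps add_divide_distrib diff_divide_distrib)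
    then show ?thesis using \<open>0 < s\<close> by (simp add: zero_le_mult_iff)
  qed
  have "((\<lambda>s. c + s * d) \<longlongrightarrow> c + 0 * d) (at_right 0)"
    by (intro tendsto_intros)
  moreover have "\<forall>\<^sub>F s in at_right 0. 0 \<le> c + s * d"
    using step by (auto simp: eventually_at_right_field intro!: exI[of _ 1])
  ultimately have "0 \<le> c"
    using tendsto_lowerbound by fastforce
  then show ?thesis by (simp add: c_def)
qed

section \<open>Maximally monotone operators and Minty's theorem\<close>

text \<open>Maximality as an existence principle: a pair lies in the graph as soon as it is monotonically
  related to the whole graph, since otherwise it could be added.\<close>

lemma maximally_monotone_iff_related:
  "maximally_monotone A \<longleftrightarrow>
     (\<forall>y w. w \<in> A y \<longleftrightarrow> (\<forall>a. \<forall>b\<in>A a. 0 \<le> inner (y - a) (w - b)))" (is "_ \<longleftrightarrow> ?R")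
proof
  assume max: "maximally_monotone A"
  then have mono: "0 \<le> inner (x - y) (u - v)" if "u \<in> A x" "v \<in> A y" for x y u v
    using that unfolding maximally_monotone_def monotone_op_def by blast
  show ?R
  proof (intro allI iffI)
    fix y w assume related: "\<forall>a. \<forall>b\<in>A a. 0 \<le> inner (y - a) (w - b)"
    define B where "B = A(y := insert w (A y))"
    have "0 \<le> inner (x - x') (u - v)" if "u \<in> B x" "v \<in> B x'" for x x' u v
    proof -
      have u: "u \<in> A x \<or> x = y \<and> u = w" and v: "v \<in> A x' \<or> x' = y \<and> v = w"
        using that by (auto simp: B_def split: if_splits)
      have "inner (x - x') (u - v) = inner (x' - x) (v - u)"
        by (simp add: inner_diff_left inner_diff_right)
      with u v show ?thesis
        using mono[of u x v x'] related[rule_format, of u x] related[rule_format, of v x'] by auto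
    qed
    then have "monotone_op B" by (simp add: monotone_op_def)
    moreover have "\<forall>x. A x \<subseteq> B x" by (auto simp: B_def)
    ultimately have "B = A"
      using max unfolding maximally_monotone_def by blast
    then show "w \<in> A y" by (metis B_def fun_upd_same insertI1)
  qed (use mono in blast)
next
  assume R: ?R
  show "maximally_monotone A"
    unfolding maximally_monotone_def
  proof (intro conjI allI impI)
    show "monotone_op A" using R unfolding monotone_op_def by blast
    fix B assume B: "monotone_op B \<and> (\<forall>x. A x \<subseteq> B x)"
    then have "B x \<subseteq> A x" for x
      using R unfolding monotone_op_def by blast
    with B show "B = A" by (auto simp: fun_eq_iff)
  qed
qed

lemma maximally_monotone_related:
  assumes "maximally_monotone A" "u \<in> A x" "v \<in> A y"
  shows "0 \<le> inner (x - y) (u - v)"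
  using assms unfolding maximally_monotone_def monotone_op_def by blast

text \<open>A supremum over the graph may be infinite; its epigraph is the intersection of the half-spaces
  belonging to the points of the graph, so closedness and convexity are immediate.\<close>

definition fitzpatrick_epigraph :: "('a::real_inner \<Rightarrow> 'a set) \<Rightarrow> (('a \<times> 'a) \<times> real) set" where
  "fitzpatrick_epigraph A =
     {((y, w), t) | y w t. \<forall>a. \<forall>b\<in>A a. inner y b + inner a w - inner a b \<le> t}"

lemma mem_fitzpatrick_epigraph:
  "((y, w), t) \<in> fitzpatrick_epigraph A \<longleftrightarrow>
     (\<forall>a. \<forall>b\<in>A a. inner y b + inner a w - inner a b \<le> t)"
  by (simp add: fitzpatrick_epigraph_def)

lemma fitzpatrick_epigraph_eq_Inter:
  "fitzpatrick_epigraph A =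
     (\<Inter>(a, b)\<in>{(a, b). b \<in> A a}. {p. inner (fst (fst p)) b + inner a (snd (fst p)) - inner a b \<le> snd p})"
  by (auto simp: fitzpatrick_epigraph_def)

lemma closed_fitzpatrick_epigraph: "closed (fitzpatrick_epigraph A)"
  unfolding fitzpatrick_epigraph_eq_Inter
  case_prod_unfold by (intro closed_INT ballI closed_Collect_le continuous_intros)

lemma convex_fitzpatrick_epigraph: "convex (fitzpatrick_epigraph A)"
proof -
  have "convex {p. inner (fst (fst p)) b + inner a (snd (fst p)) - inner a b \<le> snd p}"
    for a b :: 'a
  proof (rule convexI)
    fix p q :: "('a \<times> 'a) \<times> real" and u v :: real
    assume p: "p \<in> {p. inner (fst (fst p)) b + inner a (snd (fst p)) - inner a b \<le> snd p}"
      and q: "q \<in> {p. inner (fst (fst p)) b + inner a (snd (fst p)) - inner a b \<le> snd p}"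
      and uv: "0 \<le> u" "0 \<le> v" "u + v = 1"
    let ?L = "\<lambda>p. inner (fst (fst p)) b + inner a (snd (fst p)) :: real"
    have "u * (?L p - inner a b) + v * (?L q - inner a b) \<le> u * snd p + v * snd q"
      using p q uv by (intro add_mono mult_left_mono) auto
    moreover have "u * (?L p - inner a b) + v * (?L q - inner a b)
        = u * ?L p + v * ?L q - (u + v) * inner a b"
      by (simp only: right_diff_distrib distrib_right)
    ultimately show "u *\<^sub>R p + v *\<^sub>R q \<in> {p. ?L p - inner a b \<le> snd p}"
      using uv(3) by (simp add: inner_add_left inner_add_right distrib_left)
  qed
  then show ?thesis
    unfolding fitzpatrick_epigraph_eq_Inter case_prod_unfold by (intro convex_INT) simp
qed

lemma graph_subset_fitzpatrick_epigraph:
  assumes "maximally_monotone A" "b \<in> A a"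
  shows "((a, b), inner a b) \<in> fitzpatrick_epigraph A"
proof -
  have "inner a b' + inner a' b - inner a' b' \<le> inner a b" if "b' \<in> A a'" for a' b'
  proof -
    have "0 \<le> inner (a - a') (b - b')"
      using assms that by (rule maximally_monotone_related)
    then show ?thesis by (simp add: inner_diff_left inner_diff_right)
  qed
  then show ?thesis by (simp add: mem_fitzpatrick_epigraph)
qed

text \<open>If \<open>t < \<langle>y, w\<rangle>\<close>, then \<open>(y, w)\<close> is monotonically related to the graph, hence belongs to it,
  and taking \<open>(a, b) = (y, w)\<close> in the supremum is a contradiction.\<close>

lemma inner_le_fitzpatrick:
  assumes "maximally_monotone A" "((y, w), t) \<in> fitzpatrick_epigraph A"
  shows "inner y w \<le> t"
proof (rule ccontr)
  assume "\<not> inner y w \<le> t"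
  moreover have le: "inner y b + inner a w - inner a b \<le> t" if "b \<in> A a" for a b
    using assms(2) that by (simp add: mem_fitzpatrick_epigraph)
  ultimately have "0 \<le> inner (y - a) (w - b)" if "b \<in> A a" for a b
    using le[OF that] by (simp add: inner_diff_left inner_diff_right)
  then have "w \<in> A y"
    using assms(1) maximally_monotone_iff_related by blast
  with le[of w y] \<open>\<not> inner y w \<le> t\<close> show False by simp
qed

lemma maximally_monotone_graph_nonempty:
  assumes "maximally_monotone A"
  obtains a b where "b \<in> A a"
  using assms unfolding maximally_monotone_iff_related by blast

text \<open>The optimality condition at the minimiser \<open>(y, w)\<close>, tested on the graph, says that
  \<open>(- w, - y)\<close> is monotonically related to the graph. So \<open>- y \<in> A (- w)\<close>, and testing the condition
  once more on this very pair gives \<open>\<parallel>y + w\<parallel>\<^sup>2 \<le> 0\<close>.\<close>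

lemma minty_at_zero:
  fixes A :: "'a::{real_inner, complete_space} \<Rightarrow> 'a set"
  assumes max: "maximally_monotone A"
  obtains y where "- y \<in> A y"
proof -
  let ?K = "fitzpatrick_epigraph A"
  have sq: "(norm (y, w))\<^sup>2 = (norm y)\<^sup>2 + (norm w)\<^sup>2" for y w :: 'a
    by (simp add: norm_Pair)
  have sum_sq: "(norm (y + w))\<^sup>2 = (norm y)\<^sup>2 + (norm w)\<^sup>2 + 2 * inner y w" for y w :: 'a
    by (simp add: power2_norm_eq_inner inner_add_left inner_add_right inner_commute)
  have below: "0 \<le> t + (norm z)\<^sup>2 / 2" if "(z, t) \<in> ?K" for z t
  proof -
    obtain y w where z: "z = (y, w)" by force
    have "inner y w \<le> t"
      using inner_le_fitzpatrick[OF max] that z by blast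
    moreover have "0 \<le> (norm (y + w))\<^sup>2" by simp
    ultimately show ?thesis
      unfolding z sq sum_sq by argo
  qed
  have "?K \<noteq> {}"
    using graph_subset_fitzpatrick_epigraph[OF max] maximally_monotone_graph_nonempty[OF max]
    by blast
  then obtain z0 t0 where K0: "(z0, t0) \<in> ?K"
    and min: "\<And>z t. (z, t) \<in> ?K \<Longrightarrow> t0 + (norm z0)\<^sup>2 / 2 \<le> t + (norm z)\<^sup>2 / 2"
    using regularised_epigraph_has_minimum[OF closed_fitzpatrick_epigraph
        convex_fitzpatrick_epigraph _ below] by blast
  obtain y w where z0: "z0 = (y, w)" by force
  have yw: "inner y w \<le> t0"
    using inner_le_fitzpatrick[OF max] K0 z0 by blast
  have opt: "t0 + (norm y)\<^sup>2 + (norm w)\<^sup>2 \<le> inner a b + inner y a + inner w b" if "b \<in> A a" for a b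
    using regularised_epigraph_minimum_variational[OF convex_fitzpatrick_epigraph K0
        graph_subset_fitzpatrick_epigraph[OF max that] min]
    by (simp add: z0 power2_norm_eq_inner inner_diff_right)
  have "0 \<le> inner (- w - a) (- y - b)" if "b \<in> A a" for a b
  proof -
    have "0 \<le> (norm (y + w))\<^sup>2" by simp
    then have "- inner y w \<le> t0 + (norm y)\<^sup>2 + (norm w)\<^sup>2"
      using yw sum_sq[of y w] zero_le_power2[of "norm y"] zero_le_power2[of "norm w"] by linarith
    with opt[OF that] show ?thesis
      by (simp add: inner_diff_left inner_diff_right inner_commute)
  qed
  then have mem: "- y \<in> A (- w)"
    using max maximally_monotone_iff_related by blast
  have "(norm (y + w))\<^sup>2 \<le> 0"
    using opt[OF mem] yw unfolding sum_sq by (simp add: inner_commute)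
  then have "- w = y" by (simp add: add_eq_0_iff)
  with mem show thesis by (metis that)
qed

text \<open>The general case follows from the one at \<open>0\<close>, since translating the values of an operator keeps
  it maximally monotone.\<close>

theorem minty:
  fixes A :: "'a::{real_inner, complete_space} \<Rightarrow> 'a set"
  assumes "maximally_monotone A"
  obtains y where "x - y \<in> A y"
proof -
  define B where "B y = {v. v + x \<in> A y}" for y
  have "maximally_monotone B"
    unfolding maximally_monotone_iff_related
  proof (intro allI)
    fix y w
    have "w \<in> B y \<longleftrightarrow> (\<forall>a. \<forall>b\<in>A a. 0 \<le> inner (y - a) (w + x - b))"
      using assms maximally_monotone_iff_related[of A] by (auto simp only: B_def mem_Collect_eq)
    also have "\<dots> \<longleftrightarrow> (\<forall>a. \<forall>b\<in>B a. 0 \<le> inner (y - a) (w - b))"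
    proof (intro iffI allI ballI)
      fix a b assume "\<forall>a. \<forall>b\<in>A a. 0 \<le> inner (y - a) (w + x - b)" "b \<in> B a"
      then have "0 \<le> inner (y - a) (w + x - (b + x))" unfolding B_def by blast
      then show "0 \<le> inner (y - a) (w - b)" by simp
    next
      fix a b assume *: "\<forall>a. \<forall>b\<in>B a. 0 \<le> inner (y - a) (w - b)" "b \<in> A a"
      then have "b - x \<in> B a" by (simp add: B_def)
      with * have "0 \<le> inner (y - a) (w - (b - x))" by blast
      then show "0 \<le> inner (y - a) (w + x - b)" by (simp add: diff_diff_eq2)
    qed
    finally show "w \<in> B y \<longleftrightarrow> (\<forall>a. \<forall>b\<in>B a. 0 \<le> inner (y - a) (w - b))" .
  qed
  then obtain y where "- y \<in> B y" by (rule minty_at_zero)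
  then show thesis by (intro that) (simp add: B_def)
qed

section \<open>Resolvents are firmly nonexpansive\<close>

definition firmly_nonexpansive :: "('a::real_inner \<Rightarrow> 'a) \<Rightarrow> bool" where
  "firmly_nonexpansive T \<longleftrightarrow>
     (\<forall>x y. (norm (T x - T y))\<^sup>2 + (norm ((x - T x) - (y - T y)))\<^sup>2 \<le> (norm (x - y))\<^sup>2)"

lemma resolvent_mem:
  fixes A :: "'a::{real_inner, complete_space} \<Rightarrow> 'a set"
  assumes "maximally_monotone A"
  shows "x - resolvent A x \<in> A (resolvent A x)"
proof -
  have eq: "y \<in> op_inverse (op_add op_Id A) x \<longleftrightarrow> x - y \<in> A y" for y
  proof -
    have "(\<exists>v. x = y + v \<and> v \<in> A y) \<longleftrightarrow> x - y \<in> A y"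
      by (metis add_diff_cancel_left' add.commute diff_add_cancel)
    then show ?thesis by (simp add: op_inverse_def op_add_def op_Id_def)
  qed
  have uniq: "y = y'" if "x - y \<in> A y" "x - y' \<in> A y'" for y y'
  proof -
    have "0 \<le> inner (y - y') ((x - y) - (x - y'))"
      using assms that by (rule maximally_monotone_related)
    also have "(x - y) - (x - y') = - (y - y')" by simp
    finally have "(norm (y - y'))\<^sup>2 \<le> 0"
      by (simp only: inner_minus_right power2_norm_eq_inner neg_0_le_iff_le)
    then show ?thesis by simp
  qed
  obtain y where "x - y \<in> A y" using minty[OF assms] .
  then have "\<exists>!y. y \<in> op_inverse (op_add op_Id A) x"
    unfolding eq using uniq by blast
  then have "(THE y. y \<in> op_inverse (op_add op_Id A) x) \<in> op_inverse (op_add op_Id A) x"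
    by (rule theI')
  then show ?thesis unfolding resolvent_def eq .
qed

lemma firmly_nonexpansive_resolvent:
  fixes A :: "'a::{real_inner, complete_space} \<Rightarrow> 'a set"
  assumes "maximally_monotone A"
  shows "firmly_nonexpansive (resolvent A)"
  unfolding firmly_nonexpansive_def
proof (intro allI)
  fix x y
  define p q where "p = resolvent A x - resolvent A y"
    and "q = (x - resolvent A x) - (y - resolvent A y)"
  have "0 \<le> inner p q"
    unfolding p_def q_def
    by (rule maximally_monotone_related[OF assms resolvent_mem[OF assms] resolvent_mem[OF assms]])
  then have "(norm p)\<^sup>2 + (norm q)\<^sup>2 \<le> (norm (p + q))\<^sup>2"
    by (simp add: power2_norm_eq_inner inner_add_left inner_add_right inner_commute[of q p])
  also have "p + q = x - y" by (simp add: p_def q_def)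
  finally show "(norm (resolvent A x - resolvent A y))\<^sup>2
      + (norm ((x - resolvent A x) - (y - resolvent A y)))\<^sup>2 \<le> (norm (x - y))\<^sup>2"
    unfolding p_def q_def .
qed

lemma firmly_nonexpansive_imp_nonexpansive:
  assumes "firmly_nonexpansive T"
  shows "norm (T x - T y) \<le> norm (x - y)"
proof -
  have "(norm (T x - T y))\<^sup>2 + (norm ((x - T x) - (y - T y)))\<^sup>2 \<le> (norm (x - y))\<^sup>2"
    using assms unfolding firmly_nonexpansive_def by blast
  then have "(norm (T x - T y))\<^sup>2 \<le> (norm (x - y))\<^sup>2"
    using zero_le_power2[of "norm ((x - T x) - (y - T y))"] by linarith
  then show ?thesis by (rule power2_le_imp_le) simp
qed

text \<open>Equality in nonexpansiveness leaves no room for the second term of firm nonexpansiveness.\<close>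

lemma firmly_nonexpansive_isometric_pair:
  assumes "firmly_nonexpansive T" "norm (T x - T y) = norm (x - y)"
  shows "T x - x = T y - y"
proof -
  have "(norm (T x - T y))\<^sup>2 + (norm ((x - T x) - (y - T y)))\<^sup>2 \<le> (norm (x - y))\<^sup>2"
    using assms(1) unfolding firmly_nonexpansive_def by blast
  then have "(norm ((x - T x) - (y - T y)))\<^sup>2 \<le> 0"
    using assms(2) by simp
  then have "x - T x = y - T y" by simp
  then have "- (x - T x) = - (y - T y)" by (rule arg_cong)
  then show ?thesis by simp
qed

section \<open>Fixed points of compositions\<close>

lemma mem_Fix_iff: "x \<in> Fix S \<longleftrightarrow> S x = x"
  by (auto simp: Fix_def)

lemma foldr_comp_Cons_apply: "foldr (\<circ>) (T # Ts) id x = T (foldr (\<circ>) Ts id x)"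
  by simp

lemma nonexpansive_composition:
  assumes "\<And>T. T \<in> set Ts \<Longrightarrow> firmly_nonexpansive T"
  shows "norm (foldr (\<circ>) Ts id x - foldr (\<circ>) Ts id y) \<le> norm (x - y)"
  using assms
proof (induction Ts)
  case (Cons T Ts)
  have "norm (T (foldr (\<circ>) Ts id x) - T (foldr (\<circ>) Ts id y))
      \<le> norm (foldr (\<circ>) Ts id x - foldr (\<circ>) Ts id y)"
    by (rule firmly_nonexpansive_imp_nonexpansive) (simp add: Cons.prems)
  also have "\<dots> \<le> norm (x - y)"
    by (rule Cons.IH) (simp add: Cons.prems)
  finally show ?case unfolding foldr_comp_Cons_apply .
qed simp

lemma foldr_comp_fixed:
  assumes "\<And>T. T \<in> set Ts \<Longrightarrow> T z = z"
  shows "foldr (\<circ>) Ts id z = z"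
  using assms by (induction Ts) auto

text \<open>Every factor that moves a point decreases its distance to \<open>z\<close> strictly, so a composition that
  preserves the distance of \<open>x\<close> to \<open>z\<close> moves \<open>x\<close> at no stage.\<close>

lemma composition_preserving_distance_to_common_fixed_point:
  assumes "\<And>T. T \<in> set Ts \<Longrightarrow> firmly_nonexpansive T" "\<And>T. T \<in> set Ts \<Longrightarrow> T z = z"
    and "norm (foldr (\<circ>) Ts id x - z) = norm (x - z)"
    and "T \<in> set Ts"
  shows "T x = x"
  using assms
proof (induction Ts arbitrary: T)
  case (Cons S Ts)
  let ?u = "foldr (\<circ>) Ts id x"
  have S: "firmly_nonexpansive S" "S z = z" using Cons.prems(1,2) by simp_all
  have "norm (S ?u - z) = norm (x - z)" using Cons.prems(3) unfolding foldr_comp_Cons_apply .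
  moreover have "norm (S ?u - z) \<le> norm (?u - z)"
    using firmly_nonexpansive_imp_nonexpansive[OF S(1), of ?u z] S(2) by simp
  moreover have "norm (?u - z) \<le> norm (x - z)"
    using nonexpansive_composition[of Ts x z] foldr_comp_fixed[of Ts z] Cons.prems(1,2) by simp
  ultimately have eq: "norm (?u - z) = norm (x - z)" and Su: "norm (S ?u - S z) = norm (?u - z)"
    using S(2) by simp_all
  have Ts: "T x = x" if "T \<in> set Ts" for T
    using Cons.IH[OF _ _ eq that] Cons.prems(1,2) by simp
  then have "?u = x" by (rule foldr_comp_fixed)
  then have "S x = x"
    using firmly_nonexpansive_isometric_pair[OF S(1) Su] S(2) by simp
  with Ts Cons.prems(4) show ?case by auto
qed simp

lemma Fix_composition_eq_Inter_Fix:
  assumes "\<And>T. T \<in> set Ts \<Longrightarrow> firmly_nonexpansive T" "(\<Inter>T\<in>set Ts. Fix T) \<noteq> {}"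
  shows "Fix (foldr (\<circ>) Ts id) = (\<Inter>T\<in>set Ts. Fix T)"
proof -
  obtain z where "z \<in> (\<Inter>T\<in>set Ts. Fix T)"
    using assms(2) by blast
  then have z: "T z = z" if "T \<in> set Ts" for T
    using that by (simp add: mem_Fix_iff)
  have "x \<in> Fix T" if "x \<in> Fix (foldr (\<circ>) Ts id)" "T \<in> set Ts" for x T
    unfolding mem_Fix_iff
  proof (rule composition_preserving_distance_to_common_fixed_point[of Ts z])
    show "norm (foldr (\<circ>) Ts id x - z) = norm (x - z)"
      using that(1) unfolding mem_Fix_iff by (rule arg_cong)
  qed (use that assms(1) z in auto)
  moreover have "x \<in> Fix (foldr (\<circ>) Ts id)" if "x \<in> (\<Inter>T\<in>set Ts. Fix T)" for x
    using that foldr_comp_fixed[of Ts x] unfolding INT_iff mem_Fix_iff by blast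
  ultimately show ?thesis by blast
qed

text \<open>On \<open>F = Fix (R \<circ> J)\<close> the map \<open>J\<close> is isometric, hence a translation, and it sends \<open>F\<close> into
  \<open>Fix (J \<circ> R)\<close>. When this is \<open>F\<close> again, the orbit of a point runs along a line with constant
  step; since it stays at bounded distance from a fixed point of \<open>J\<close>, the step is zero.\<close>

lemma Fix_commuted_composition_subset_Fix:
  fixes J R :: "'a::real_inner \<Rightarrow> 'a"
  assumes J: "firmly_nonexpansive J"
    and R: "\<And>x y. norm (R x - R y) \<le> norm (x - y)"
    and "Fix J \<noteq> {}"
    and Fix_eq: "Fix (R \<circ> J) = Fix (J \<circ> R)"
  shows "Fix (R \<circ> J) \<subseteq> Fix J"
proof
  fix x assume x: "x \<in> Fix (R \<circ> J)"
  obtain p where p: "J p = p" using \<open>Fix J \<noteq> {}\<close> by (auto simp: mem_Fix_iff)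
  have translation: "J y - y = J x - x" if "y \<in> Fix (R \<circ> J)" for y
  proof (rule firmly_nonexpansive_isometric_pair[OF J])
    have "norm (y - x) = norm (R (J y) - R (J x))"
      using that x by (simp add: mem_Fix_iff)
    also have "\<dots> \<le> norm (J y - J x)" by (rule R)
    finally show "norm (J y - J x) = norm (y - x)"
      using firmly_nonexpansive_imp_nonexpansive[OF J, of y x] by simp
  qed
  have invariant: "J y \<in> Fix (R \<circ> J)" if "y \<in> Fix (R \<circ> J)" for y
  proof -
    have "J y \<in> Fix (J \<circ> R)"
      using that by (simp add: mem_Fix_iff)
    then show ?thesis unfolding Fix_eq .
  qed
  have orbit: "x + real n *\<^sub>R (J x - x) \<in> Fix (R \<circ> J)
      \<and> norm (x + real n *\<^sub>R (J x - x) - p) \<le> norm (x - p)" for n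
  proof (induction n)
    case (Suc n)
    let ?y = "x + real n *\<^sub>R (J x - x)"
    have "J ?y = ?y + (J x - x)"
      using translation[of ?y] Suc by (metis add.commute diff_add_cancel)
    then have "J ?y = x + real (Suc n) *\<^sub>R (J x - x)"
      by (simp add: scaleR_left_distrib)
    moreover have "norm (J ?y - p) \<le> norm (?y - p)"
      using firmly_nonexpansive_imp_nonexpansive[OF J, of ?y p] p by simp
    ultimately show ?case using invariant Suc by (metis order_trans)
  qed (use x in \<open>simp add: mem_Fix_iff\<close>)
  have bounded: "real n * norm (J x - x) \<le> 2 * norm (x - p)" for n
  proof -
    have "real n * norm (J x - x) = norm ((x + real n *\<^sub>R (J x - x) - p) - (x - p))"
      by simp
    also have "\<dots> \<le> norm (x + real n *\<^sub>R (J x - x) - p) + norm (x - p)"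
      by (rule norm_triangle_ineq4)
    also have "\<dots> \<le> 2 * norm (x - p)" using orbit[of n] by simp
    finally show ?thesis .
  qed
  have "norm (J x - x) = 0"
  proof (rule ccontr)
    assume "norm (J x - x) \<noteq> 0"
    then obtain n where "2 * norm (x - p) < real n * norm (J x - x)"
      using reals_Archimedean3[of "norm (J x - x)"] by auto
    with bounded[of n] show False by simp
  qed
  then show "x \<in> Fix J" by (simp add: mem_Fix_iff)
qed

section \<open>Cyclic compositions of resolvents\<close>

lemma foldr_comp_append:
  "foldr (\<circ>) (Ss @ Ts) id = foldr (\<circ>) Ss id \<circ> foldr (\<circ>) Ts id"
  by (induction Ss) auto

lemma cyclic_comp_0: "cyclic_comp J m 0 = cyclic_comp J m m"
  by (simp add: cyclic_comp_def)

text \<open>Consecutive compositions differ by moving the factor applied first to the end. The case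
  \<open>i = 0\<close> is the step from \<open>m\<close> to \<open>1\<close>, by \<open>cyclic_comp_0\<close>.\<close>

lemma cyclic_comp_rotate:
  assumes "i < m"
  obtains ks where "set ks \<subseteq> {1..m}"
    and "cyclic_comp J m i = foldr (\<circ>) (map J ks) id \<circ> J (Suc i)"
    and "cyclic_comp J m (Suc i) = J (Suc i) \<circ> foldr (\<circ>) (map J ks) id"
proof
  let ?ks = "rev [1..<Suc i] @ rev [Suc (Suc i)..<Suc m]"
  show "set ?ks \<subseteq> {1..m}" using assms by auto
  have eq: "rev [1..<Suc i] @ rev [Suc i..<Suc m] = ?ks @ [Suc i]"
    using assms by (simp add: upt_conv_Cons del: upt_Suc)
  show "cyclic_comp J m i = foldr (\<circ>) (map J ?ks) id \<circ> J (Suc i)"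
    unfolding cyclic_comp_def eq map_append[of J ?ks] foldr_comp_append[of "map J ?ks"] by simp
  show "cyclic_comp J m (Suc i) = J (Suc i) \<circ> foldr (\<circ>) (map J ?ks) id"
    unfolding cyclic_comp_def by (simp add: comp_assoc)
qed

theorem lemma4p7:
  fixes A :: "nat \<Rightarrow> 'a::{real_inner, complete_space} \<Rightarrow> 'a set"
    and m :: nat
  assumes "m \<ge> 2"
    and "\<And>i. i \<in> {1..m} \<Longrightarrow> maximally_monotone (A i)"
    and "\<And>i. i \<in> {1..m} \<Longrightarrow> Fix (resolvent (A i)) \<noteq> {}"
  shows "(\<Inter>i\<in>{1..m}. Fix (resolvent (A i))) \<noteq> {} \<longleftrightarrow>
         (\<forall>i\<in>{1..<m}. cyclic_Fix A m i = cyclic_Fix A m (Suc i)) \<and> cyclic_Fix A m m \<noteq> {}"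
proof -
  let ?J = "\<lambda>k. resolvent (A k)"
  have firm: "firmly_nonexpansive (?J k)" if "k \<in> {1..m}" for k
    using assms(2)[OF that] by (rule firmly_nonexpansive_resolvent)
  show ?thesis
  proof
    assume common: "(\<Inter>i\<in>{1..m}. Fix (?J i)) \<noteq> {}"
    have "cyclic_Fix A m i = (\<Inter>k\<in>{1..m}. Fix (?J k))" if "i \<in> {1..m}" for i
    proof -
      let ?Ts = "map ?J (rev [1..<Suc i] @ rev [Suc i..<Suc m])"
      have set: "set ?Ts = ?J ` {1..m}"
        using that by (auto simp del: upt_Suc simp: image_Un[symmetric])
      have "Fix (foldr (\<circ>) ?Ts id) = (\<Inter>T\<in>set ?Ts. Fix T)"
        using firm common by (intro Fix_composition_eq_Inter_Fix) (auto simp only: set image_iff)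
      then show ?thesis
        unfolding cyclic_Fix_def cyclic_comp_def set by simp
    qed
    then show "(\<forall>i\<in>{1..<m}. cyclic_Fix A m i = cyclic_Fix A m (Suc i)) \<and> cyclic_Fix A m m \<noteq> {}"
      using common assms(1) by auto
  next
    assume cyc: "(\<forall>i\<in>{1..<m}. cyclic_Fix A m i = cyclic_Fix A m (Suc i)) \<and> cyclic_Fix A m m \<noteq> {}"
    have all_eq: "cyclic_Fix A m i = cyclic_Fix A m m" if "1 \<le> i" "i \<le> m" for i
      using that(2,1)
    proof (induction rule: inc_induct)
      case (step n)
      with cyc show ?case by simp
    qed simp
    have zero: "cyclic_Fix A m 0 = cyclic_Fix A m m"
      by (simp add: cyclic_Fix_def cyclic_comp_0)
    \<comment> \<open>Starting at \<open>i = 0\<close>, where \<open>F\<^sub>0 = F\<^sub>m\<close>, lets each \<open>J\<^sub>k\<close> with \<open>1 \<le> k \<le> m\<close> occur as the rotated factor.\<close>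
    have "cyclic_Fix A m m \<subseteq> Fix (?J (Suc i))" if i: "i < m" for i
    proof -
      obtain ks where ks: "set ks \<subseteq> {1..m}"
        and comp: "cyclic_comp ?J m i = foldr (\<circ>) (map ?J ks) id \<circ> ?J (Suc i)"
          "cyclic_comp ?J m (Suc i) = ?J (Suc i) \<circ> foldr (\<circ>) (map ?J ks) id"
        using cyclic_comp_rotate[OF i, of ?J] by metis
      have F: "cyclic_Fix A m i = cyclic_Fix A m m"
        using all_eq[of i] zero i by (cases "i = 0") simp_all
      have F_Suc: "cyclic_Fix A m (Suc i) = cyclic_Fix A m m"
        using all_eq[of "Suc i"] i by simp
      have "Fix (foldr (\<circ>) (map ?J ks) id \<circ> ?J (Suc i)) \<subseteq> Fix (?J (Suc i))"
      proof (rule Fix_commuted_composition_subset_Fix)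
        show "norm (foldr (\<circ>) (map ?J ks) id x - foldr (\<circ>) (map ?J ks) id y) \<le> norm (x - y)" for x y
          using firm ks by (intro nonexpansive_composition) auto
        show "Fix (foldr (\<circ>) (map ?J ks) id \<circ> ?J (Suc i))
            = Fix (?J (Suc i) \<circ> foldr (\<circ>) (map ?J ks) id)"
          using F F_Suc unfolding cyclic_Fix_def comp by (rule trans[OF _ sym])
      qed (use firm assms(3) i in auto)
      then show ?thesis
        unfolding F[symmetric] unfolding cyclic_Fix_def comp .
    qed
    then have "cyclic_Fix A m m \<subseteq> Fix (?J k)" if "k \<in> {1..m}" for k
      using that by (cases k) auto
    with cyc show "(\<Inter>i\<in>{1..m}. Fix (?J i)) \<noteq> {}" by blast
  qed
qed

end
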